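(* Let $n\ge1$, $\alpha\in(0,1)$, $\nu\in\mathbb{S}^{n-1}$ and $x_0\in\mathbb{R}^n$. Then $$\nabla^\alpha\chi_{H_\nu^+(x_0)}(x)=\frac{\mu_{1,\alpha}}{\alpha}\,\frac{\nu}{|(x-x_0)\cdot\nu|^\alpha}$$ for all $x\in\mathbb{R}^n\setminus H_\nu(x_0)$.
   Context: Let $\mu_{n,\alpha}=2^{\alpha}\pi^{-n/2}\,\Gamma\left(\frac{n+\alpha+1}{2}\right)/\Gamma\left(\frac{1-\alpha}{2}\right)$. The fractional $\alpha$-gradient of $f:\mathbb{R}^n\to\mathbb{R}$ at $x$ is $$\nabla^\alpha f(x)=\mu_{n,\alpha}\int_{\mathbb{R}^n}\frac{(y-x)(f(y)-f(x))}{|y-x|^{n+\alpha+1}}\,dy$$ whenever the integral converges absolutely (as it does for $f=\chi_{H_\nu^+(x_0)}$ and $x\notin H_\nu(x_0)$). Here $H_\nu^+(x_0)=\{y\in\mathbb{R}^n:(y-x_0)\cdot\nu>0\}$, $H_\nu(x_0)=\{y\in\mathbb{R}^n:(y-x_0)\cdot\nu=0\}$, and $\chi_A$ is the characteristic function of $A$. *)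

theory Defs
  imports "HOL-Analysis.Analysis"
begin

definition frac_const :: "nat \<Rightarrow> real \<Rightarrow> real" where
  "frac_const n \<alpha> =
     2 powr \<alpha> * pi powr (- (real n / 2)) * Gamma ((real n + \<alpha> + 1) / 2) / Gamma ((1 - \<alpha>) / 2)"

text \<open>At the single point y = x the integrand takes the value 0 here, by the conventions for
  powr and division at 0; this point is a null set.\<close>

definition frac_integrand :: "real \<Rightarrow> (real ^ 'n \<Rightarrow> real) \<Rightarrow> real ^ 'n \<Rightarrow> real ^ 'n \<Rightarrow> real ^ 'n" where
  "frac_integrand \<alpha> f x y =
     ((f y - f x) / norm (y - x) powr (real CARD('n) + \<alpha> + 1)) *\<^sub>R (y - x)"

text \<open>Absolute convergence is Bochner integrability. Where it fails, the gradient is undefined in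
  the mathematical sense, and the value of \<^term>\<open>frac_gradient\<close> is meaningless (it is 0).\<close>

definition frac_gradient_exists :: "real \<Rightarrow> (real ^ 'n \<Rightarrow> real) \<Rightarrow> real ^ 'n \<Rightarrow> bool" where
  "frac_gradient_exists \<alpha> f x \<longleftrightarrow> integrable lebesgue (frac_integrand \<alpha> f x)"

definition frac_gradient :: "real \<Rightarrow> (real ^ 'n \<Rightarrow> real) \<Rightarrow> real ^ 'n \<Rightarrow> real ^ 'n" where
  "frac_gradient \<alpha> f x =
     frac_const CARD('n) \<alpha> *\<^sub>R (LINT y|lebesgue. frac_integrand \<alpha> f x y)"

definition open_halfspace :: "'a::real_inner \<Rightarrow> 'a \<Rightarrow> 'a set" where
  "open_halfspace \<nu> x0 = {y. (y - x0) \<bullet> \<nu> > 0}"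

definition boundary_hyperplane :: "'a::real_inner \<Rightarrow> 'a \<Rightarrow> 'a set" where
  "boundary_hyperplane \<nu> x0 = {y. (y - x0) \<bullet> \<nu> = 0}"

end

theory Submission
  imports Defs "HOL-Probability.Distributions"
begin

text \<open>Translating \<open>x\<close> to the origin turns the integrand into \<open>z / |z|\<^sup>n\<^sup>+\<^sup>\<alpha>\<^sup>+\<^sup>1\<close> on a half-space
  \<open>{z. z \<bullet> \<nu> > t}\<close>, up to exchanging \<open>\<nu>\<close> for \<open>- \<nu>\<close>, with \<open>t\<close> the distance from \<open>x\<close> to the
  hyperplane. By symmetry under the reflection that fixes \<open>\<nu>\<close> and negates its orthogonal complement, only the
  \<open>\<nu>\<close>-component of the integral survives. To compute it, write \<open>|z|\<close> to a negative power as a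
  superposition of Gaussians \<open>exp (- u |z|\<^sup>2)\<close> by means of the Gamma integral. These split into a product along
  \<open>\<nu>\<close> and its complement, which integrates out the \<open>n - 1\<close> orthogonal directions and leaves
  the integral of \<open>s powr (- \<alpha> - 1)\<close> over \<open>s > t\<close>.\<close>

section \<open>Invariance of Lebesgue measure under orthogonal maps\<close>

text \<open>The index type of the matrix-based change of variables theorems must be a well-order, so orthogonal
  invariance is derived here from the uniqueness of translation-invariant measures: comparing the two
  measures against the unit ball \<open>B\<close>, which \<open>T\<close> preserves, by exchanging the order of integration.\<close>

lemma lborel_distr_orthogonal_transformation:
  fixes T :: "'a::euclidean_space \<Rightarrow> 'a"
  assumes T: "orthogonal_transformation T"
  shows "distr lborel borel T = lborel"
proof (rule measure_eqI)
  have lin: "linear T" and norm_T: "norm (T x) = norm x" for x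
    using T by (auto simp: orthogonal_transformation)
  have [measurable]: "T \<in> borel \<rightarrow>\<^sub>M borel"
    using lin by (intro borel_measurable_continuous_onI linear_continuous_on linear_conv_bounded_linear[THEN iffD1])
  have trans: "(\<integral>\<^sup>+x. f (c + x) \<partial>lborel) = (\<integral>\<^sup>+x. f x \<partial>lborel)"
    if [measurable]: "f \<in> borel_measurable borel" for f :: "'a \<Rightarrow> ennreal" and c
    by (subst (2) lborel_distr_plus[symmetric, of c]) (simp add: nn_integral_distr)
  fix A assume "A \<in> sets (distr lborel borel T)"
  then have A [measurable]: "A \<in> sets borel"
    by simp
  define B where "B = ball (0 :: 'a) 1"
  have [measurable]: "B \<in> sets borel"
    by (simp add: B_def)
  \<comment> \<open>The product becomes a double integral. For fixed \<open>y\<close>, translating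
    \<open>x\<close> by a preimage of \<open>y\<close> under \<open>T\<close> gives the integrand
    \<open>indicator A (y + T x) * indicator B y\<close>; for fixed \<open>x\<close>, translating
    \<open>y\<close> by \<open>T x\<close> then moves the dependence on \<open>T\<close> from
    \<open>A\<close> to \<open>B\<close>, where it is harmless.\<close>
  have "emeasure (distr lborel borel T) A * emeasure lborel B
      = (\<integral>\<^sup>+y. (\<integral>\<^sup>+x. indicator A (T x) \<partial>lborel) * indicator B y \<partial>lborel)"
    by (simp add: nn_integral_cmult nn_integral_distr nn_integral_indicator[symmetric] del: nn_integral_indicator)
  also have "\<dots> = (\<integral>\<^sup>+y. \<integral>\<^sup>+x. indicator A (y + T x) * indicator B y \<partial>lborel \<partial>lborel)"
  proof (rule nn_integral_cong)
    fix y
    obtain c where c: "T c = y"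
      using orthogonal_transformation_surj[OF T] by (metis surjD)
    have "(\<integral>\<^sup>+x. indicator A (T x) \<partial>lborel) = (\<integral>\<^sup>+x. indicator A (T (c + x)) \<partial>lborel)"
      by (rule trans[symmetric]) measurable
    then show "(\<integral>\<^sup>+x. indicator A (T x) \<partial>lborel) * indicator B y
        = (\<integral>\<^sup>+x. indicator A (y + T x) * indicator B y \<partial>lborel)"
      by (simp add: nn_integral_multc linear_add[OF lin] c)
  qed
  also have "\<dots> = (\<integral>\<^sup>+x. \<integral>\<^sup>+y. indicator A (y + T x) * indicator B y \<partial>lborel \<partial>lborel)"
    by (rule lborel_pair.Fubini') measurable
  also have "\<dots> = (\<integral>\<^sup>+x. \<integral>\<^sup>+y. indicator A y * indicator B (y - T x) \<partial>lborel \<partial>lborel)"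
  proof (rule nn_integral_cong)
    fix x
    have "(\<integral>\<^sup>+y. indicator A y * indicator B (y - T x) \<partial>lborel) =
      (\<integral>\<^sup>+y. indicator A (T x + y) * indicator B (T x + y - T x) \<partial>lborel)"
      by (rule trans[symmetric]) measurable
    then show "(\<integral>\<^sup>+y. indicator A (y + T x) * indicator B y \<partial>lborel) =
      (\<integral>\<^sup>+y. indicator A y * indicator B (y - T x) \<partial>lborel)"
      by (simp add: add.commute)
  qed
  also have "\<dots> = (\<integral>\<^sup>+y. \<integral>\<^sup>+x. indicator A y * indicator B (y - T x) \<partial>lborel \<partial>lborel)"
    by (rule lborel_pair.Fubini') measurable
  also have "\<dots> = (\<integral>\<^sup>+y. indicator A y * emeasure lborel B \<partial>lborel)"
  proof (rule nn_integral_cong)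
    fix y
    obtain c where c: "T c = y"
      using orthogonal_transformation_surj[OF T] by (metis surjD)
    \<comment> \<open>Here \<open>y - T (c + x) = - T x\<close>, which has the norm of
      \<open>x\<close>, and membership in \<open>B\<close> depends on the norm alone.\<close>
    have "indicator B (y - T (c + x)) = (indicator B x :: ennreal)" for x
      by (simp add: linear_add[OF lin] c B_def norm_T indicator_def)
    moreover have "(\<integral>\<^sup>+x. indicator B (y - T x) \<partial>lborel) = (\<integral>\<^sup>+x. indicator B (y - T (c + x)) \<partial>lborel)"
      by (rule trans[symmetric]) measurable
    ultimately show "(\<integral>\<^sup>+x. indicator A y * indicator B (y - T x) \<partial>lborel) = indicator A y * emeasure lborel B"
      by (simp add: nn_integral_cmult)
  qed
  also have "\<dots> = emeasure lborel A * emeasure lborel B"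
    by (simp add: nn_integral_multc)
  finally have "emeasure lborel B * emeasure (distr lborel borel T) A = emeasure lborel B * emeasure lborel A"
    by (simp add: mult.commute)
  \<comment> \<open>Cancelling the common factor in \<open>ennreal\<close> requires it to be neither
    zero nor infinite.\<close>
  moreover have "emeasure lborel B \<noteq> 0" "emeasure lborel B \<noteq> top"
    by (auto simp: B_def emeasure_ball unit_ball_vol_def Gamma_eq_zero_iff)
  ultimately show "emeasure (distr lborel borel T) A = emeasure lborel A"
    by (metis ennreal_mult_cancel_left)
qed simp

section \<open>One-dimensional Gamma and Gaussian integrals\<close>

text \<open>This is Euler's integral after the substitution \<open>u = t / c\<close>. Read from
  right to left with \<open>c\<close> a squared norm, it expresses a negative power of that norm
  through Gaussians.\<close>

lemma nn_integral_powr_exp: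
  fixes c p :: real
  assumes "c > 0" "p > 0"
  shows "(\<integral>\<^sup>+u. ennreal (indicator {0<..} u * (u powr (p - 1) * exp (- (c * u)))) \<partial>lborel)
    = ennreal (Gamma p * c powr - p)"
proof -
  have "(\<integral>\<^sup>+u. ennreal (indicator {0<..} u * (u powr (p - 1) * exp (- (c * u)))) \<partial>lborel)
      = ennreal \<bar>1 / c\<bar> * (\<integral>\<^sup>+t. ennreal (indicator {0<..} (0 + 1 / c * t) *
          ((0 + 1 / c * t) powr (p - 1) * exp (- (c * (0 + 1 / c * t))))) \<partial>lborel)"
    using assms by (intro nn_integral_real_affine) auto
  also have "(\<integral>\<^sup>+t. ennreal (indicator {0<..} (0 + 1 / c * t) *
          ((0 + 1 / c * t) powr (p - 1) * exp (- (c * (0 + 1 / c * t))))) \<partial>lborel)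
      = (\<integral>\<^sup>+t. ennreal (c powr (1 - p)) * ennreal (indicator {0..} t * t powr (p - 1) / exp t) \<partial>lborel)"
  proof (rule nn_integral_cong_AE, rule AE_mp[OF AE_lborel_singleton[of 0]], intro AE_I2 impI)
    fix t :: real assume "t \<noteq> 0"
    have "(t / c) powr (p - 1) = c powr (1 - p) * t powr (p - 1)" if "t > 0"
    proof -
      have "(t / c) powr (p - 1) = t powr (p - 1) / c powr (p - 1)"
        by (rule powr_divide)
      moreover have "c powr (1 - p) = inverse (c powr (p - 1))"
        using powr_minus[of c "p - 1"] by simp
      then have "t powr (p - 1) / c powr (p - 1) = c powr (1 - p) * t powr (p - 1)"
        by (simp only: divide_inverse mult.commute)
      ultimately show ?thesis
        by simp
    qed
    with \<open>t \<noteq> 0\<close> assms show "ennreal (indicator {0<..} (0 + 1 / c * t) *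
          ((0 + 1 / c * t) powr (p - 1) * exp (- (c * (0 + 1 / c * t)))))
       = ennreal (c powr (1 - p)) * ennreal (indicator {0..} t * t powr (p - 1) / exp t)"
      by (auto simp: ennreal_mult'[symmetric] indicator_def exp_minus zero_less_mult_iff divide_inverse mult_ac)
  qed
  also have "\<dots> = ennreal (c powr (1 - p)) * ennreal (Gamma p)"
    using assms by (simp add: nn_integral_cmult Gamma_conv_nn_integral_real)
  also have "ennreal \<bar>1 / c\<bar> * \<dots> = ennreal (Gamma p * c powr - p)"
    using assms powr_add[of c "-1" "1 - p"]
    by (simp add: ennreal_mult'[symmetric] powr_minus_divide)
  finally show ?thesis .
qed

lemma nn_integral_gaussian:
  fixes u :: real
  assumes "u > 0"
  shows "(\<integral>\<^sup>+s. ennreal (exp (- (u * s\<^sup>2))) \<partial>lborel) = ennreal (sqrt (pi / u))"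
proof -
  \<comment> \<open>\<open>gaussian_moment_0\<close> concerns the half-line; evenness doubles its
    value.\<close>
  have "integrable lborel (\<lambda>x. exp (- x\<^sup>2) :: real)" "(\<integral>x. exp (- x\<^sup>2) \<partial>lborel) = sqrt pi"
    using has_bochner_integral_even_function[OF gaussian_moment_0]
    by (simp_all add: has_bochner_integral_iff)
  then have *: "(\<integral>\<^sup>+x. ennreal (exp (- x\<^sup>2)) \<partial>lborel) = ennreal (sqrt pi)"
    by (simp add: nn_integral_eq_integral)
  have "ennreal (sqrt pi) = ennreal (sqrt u) * (\<integral>\<^sup>+s. ennreal (exp (- (u * s\<^sup>2))) \<partial>lborel)"
    using assms unfolding *[symmetric]
    by (subst nn_integral_real_affine[where c = "sqrt u" and t = 0]) (auto simp: power_mult_distrib)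
  then have "ennreal (1 / sqrt u) * ennreal (sqrt pi)
     = ennreal (1 / sqrt u) * ennreal (sqrt u) * (\<integral>\<^sup>+s. ennreal (exp (- (u * s\<^sup>2))) \<partial>lborel)"
    by (simp add: mult.assoc)
  then show ?thesis
    using assms by (simp add: ennreal_mult'[symmetric] real_sqrt_divide)
qed

section \<open>Reduction of ridge integrals to one dimension\<close>

text \<open>A rotation takes a coordinate vector to \<open>\<nu>\<close>. The integrand is then a
  product of functions of single coordinates, so the integral factorises, and each of the other
  coordinates contributes \<open>sqrt (pi / u)\<close>.\<close>

lemma nn_integral_ridge_gaussian:
  fixes \<nu> :: "real ^ 'n" and g :: "real \<Rightarrow> real"
  assumes \<nu>: "norm \<nu> = 1" and u: "u > 0"
    and g [measurable]: "g \<in> borel_measurable borel" and g_nonneg: "\<And>s. g s \<ge> 0"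
  shows "(\<integral>\<^sup>+z. ennreal (g (z \<bullet> \<nu>) * exp (- (u * (norm z)\<^sup>2))) \<partial>lborel)
    = ennreal (sqrt (pi / u) ^ (CARD('n) - 1)) * (\<integral>\<^sup>+s. ennreal (g s * exp (- (u * s\<^sup>2))) \<partial>lborel)"
proof -
  \<comment> \<open>\<open>undefined\<close> stands for an arbitrary index: any coordinate direction
    serves.\<close>
  define e :: "real ^ 'n" where "e = axis undefined 1"
  have e: "e \<in> Basis" "norm e = 1"
    by (simp_all add: e_def axis_in_Basis_iff)
  obtain T where T: "orthogonal_transformation T" "T e = \<nu>"
    using orthogonal_transformation_exists_1[OF e(2) \<nu>] by metis
  have inner_T: "T x \<bullet> \<nu> = x \<bullet> e" and norm_T: "norm (T x) = norm x" for x
    using T by (auto simp: orthogonal_transformation_def orthogonal_transformation_norm)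
  have [measurable]: "T \<in> borel \<rightarrow>\<^sub>M borel"
    using T by (intro borel_measurable_continuous_onI linear_continuous_on
        linear_conv_bounded_linear[THEN iffD1] orthogonal_transformation_linear)
  \<comment> \<open>The weight \<open>g\<close> is attached to the coordinate \<open>e\<close> only;
    every other factor is a pure Gaussian.\<close>
  define f where "f b s = (if b = e then g s else 1) * exp (- (u * s\<^sup>2))" for b :: "real ^ 'n" and s :: real
  have [measurable]: "f b \<in> borel_measurable borel" for b
    by (cases "b = e") (simp_all add: f_def [abs_def])
  have f_nonneg: "f b s \<ge> 0" for b s
    by (simp add: f_def g_nonneg)
  have prod_f: "(\<Prod>b\<in>Basis. f b (z \<bullet> b)) = g (z \<bullet> e) * exp (- (u * (norm z)\<^sup>2))" for z :: "real ^ 'n"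
  proof -
    have "(\<Prod>b\<in>Basis. f b (z \<bullet> b)) = (\<Prod>b\<in>Basis. if b = e then g (z \<bullet> b) else 1) * (\<Prod>b\<in>Basis. exp (- (u * (z \<bullet> b)\<^sup>2)))"
      by (simp add: f_def prod.distrib)
    also have "(\<Prod>b\<in>Basis. if b = e then g (z \<bullet> b) else 1) = g (z \<bullet> e)"
      using e by simp
    also have "(\<Prod>b\<in>Basis. exp (- (u * (z \<bullet> b)\<^sup>2))) = exp (- (u * (norm z)\<^sup>2))"
      by (simp add: exp_sum[symmetric] sum_negf sum_distrib_left[symmetric] power2_norm_eq_inner
          euclidean_inner[of z z] power2_eq_square[symmetric])
    finally show ?thesis .
  qed
  have "(\<integral>\<^sup>+z. ennreal (g (z \<bullet> \<nu>) * exp (- (u * (norm z)\<^sup>2))) \<partial>lborel)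
      = (\<integral>\<^sup>+z. ennreal (g (z \<bullet> e) * exp (- (u * (norm z)\<^sup>2))) \<partial>lborel)"
    by (subst lborel_distr_orthogonal_transformation[OF T(1), symmetric])
      (simp add: nn_integral_distr inner_T norm_T)
  also have "\<dots> = (\<integral>\<^sup>+z. (\<Prod>b\<in>Basis. ennreal (f b (z \<bullet> b))) \<partial>lborel)"
    by (simp add: prod_ennreal f_nonneg prod_f)
  also have "\<dots> = (\<Prod>b\<in>Basis. \<integral>\<^sup>+s. ennreal (f b s) \<partial>lborel)"
    by (rule nn_integral_lborel_prod) auto
  also have "\<dots> = (\<integral>\<^sup>+s. ennreal (f e s) \<partial>lborel) * (\<Prod>b\<in>Basis - {e}. \<integral>\<^sup>+s. ennreal (f b s) \<partial>lborel)"
    using e by (intro prod.remove) auto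
  also have "(\<Prod>b\<in>Basis - {e}. \<integral>\<^sup>+s. ennreal (f b s) \<partial>lborel) = (\<Prod>b\<in>Basis - {e}. ennreal (sqrt (pi / u)))"
    by (intro prod.cong) (simp_all add: f_def nn_integral_gaussian[OF u])
  also have "\<dots> = ennreal (sqrt (pi / u) ^ (CARD('n) - 1))"
    using e u by (simp add: card_Diff_singleton ennreal_power)
  finally show ?thesis
    by (simp add: f_def mult.commute)
qed

text \<open>After multiplication by \<open>Gamma p\<close>, the power of the norm is an integral of
  Gaussians over \<open>u\<close>. Integrating \<open>z\<close> first brings out
  \<open>(pi / u)\<close> to the power \<open>(n - 1) / 2\<close>, and the remaining integral over
  \<open>u\<close> is again a Gamma integral, with a smaller exponent. The weight \<open>g\<close>
  is left general so that both the norm and the \<open>\<nu>\<close>-component of the kernel can be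
  treated.\<close>

lemma nn_integral_ridge_powr:
  fixes \<nu> :: "real ^ 'n" and g :: "real \<Rightarrow> real"
  assumes \<nu>: "norm \<nu> = 1" and p: "p > (real CARD('n) - 1) / 2"
    and g [measurable]: "g \<in> borel_measurable borel" and g_nonneg: "\<And>s. g s \<ge> 0" and g_0: "g 0 = 0"
  shows "(\<integral>\<^sup>+z. ennreal (g (z \<bullet> \<nu>) * norm z powr (- (2 * p))) \<partial>lborel)
    = ennreal (pi powr ((real CARD('n) - 1) / 2) * Gamma (p - (real CARD('n) - 1) / 2) / Gamma p)
      * (\<integral>\<^sup>+s. ennreal (g s * \<bar>s\<bar> powr (real CARD('n) - 1 - 2 * p)) \<partial>lborel)"
proof -
  define m where "m = (real CARD('n) - 1) / 2"
  \<comment> \<open>The exponent left once the orthogonal Gaussians have contributed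
    \<open>u powr - m\<close>. The bound on \<open>p\<close> says exactly that \<open>q > 0\<close>,
    so the final Gamma integral converges.\<close>
  define q where "q = p - m"
  define k where "k u = indicator {0<..} u * u powr (p - 1)" for u :: real
  have [measurable]: "k \<in> borel_measurable borel"
    by (simp add: k_def [abs_def])
  have k_nonneg: "k u \<ge> 0" for u
    by (simp add: k_def)
  have "CARD('n) \<ge> 1"
    by (simp add: Suc_leI)
  then have m_nonneg: "m \<ge> 0"
    by (simp add: m_def)
  have q_pos: "q > 0"
    using p by (simp add: m_def q_def)
  then have p_pos: "p > 0"
    using m_nonneg by (simp add: q_def)
  have pow: "norm z powr (- (2 * p)) = (norm z)\<^sup>2 powr - p" for z :: "'b::real_normed_vector"
    by (cases "z = 0") (simp_all add: powr_numeral[symmetric] powr_powr del: powr_numeral)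
  have powr: "(\<integral>\<^sup>+u. ennreal (k u * exp (- (u * (norm z)\<^sup>2))) \<partial>lborel) = ennreal (Gamma p * norm z powr (- (2 * p)))"
    if "z \<noteq> 0" for z :: "real ^ 'n"
    unfolding pow using nn_integral_powr_exp[of "(norm z)\<^sup>2" p] that p_pos
    by (simp add: k_def mult.assoc mult.commute[of _ "(norm z)\<^sup>2"])
  have "ennreal (Gamma p) * (\<integral>\<^sup>+z. ennreal (g (z \<bullet> \<nu>) * norm z powr (- (2 * p))) \<partial>lborel)
      = (\<integral>\<^sup>+z. ennreal (g (z \<bullet> \<nu>)) * ennreal (Gamma p * norm z powr (- (2 * p))) \<partial>lborel)"
    using p_pos by (subst nn_integral_cmult[symmetric])
      (auto intro!: nn_integral_cong simp: ennreal_mult[symmetric] g_nonneg Gamma_real_pos mult_ac)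
  also have "\<dots> = (\<integral>\<^sup>+z. \<integral>\<^sup>+u. ennreal (k u * (g (z \<bullet> \<nu>) * exp (- (u * (norm z)\<^sup>2)))) \<partial>lborel \<partial>lborel)"
  proof (rule nn_integral_cong)
    fix z :: "real ^ 'n"
    show "ennreal (g (z \<bullet> \<nu>)) * ennreal (Gamma p * norm z powr (- (2 * p)))
        = (\<integral>\<^sup>+u. ennreal (k u * (g (z \<bullet> \<nu>) * exp (- (u * (norm z)\<^sup>2)))) \<partial>lborel)"
    \<comment> \<open>At the origin the rate in the Gamma integral would be zero and its formula
      fails; \<open>g 0 = 0\<close> makes both sides vanish. The same happens below at
      \<open>s = 0\<close>.\<close>
    proof (cases "z = 0")
      case False
      have "(\<integral>\<^sup>+u. ennreal (k u * (g (z \<bullet> \<nu>) * exp (- (u * (norm z)\<^sup>2)))) \<partial>lborel)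
          = (\<integral>\<^sup>+u. ennreal (g (z \<bullet> \<nu>)) * ennreal (k u * exp (- (u * (norm z)\<^sup>2))) \<partial>lborel)"
        by (intro nn_integral_cong) (simp add: ennreal_mult[symmetric] g_nonneg k_nonneg mult_ac)
      then show ?thesis
        using False by (simp add: nn_integral_cmult powr)
    qed (simp add: g_0)
  qed
  also have "\<dots> = (\<integral>\<^sup>+u. \<integral>\<^sup>+z. ennreal (k u * (g (z \<bullet> \<nu>) * exp (- (u * (norm z)\<^sup>2)))) \<partial>lborel \<partial>lborel)"
    by (rule lborel_pair.Fubini'[symmetric]) measurable
  also have "\<dots> = (\<integral>\<^sup>+u. \<integral>\<^sup>+s. ennreal (k u * sqrt (pi / u) ^ (CARD('n) - 1) * (g s * exp (- (u * s\<^sup>2)))) \<partial>lborel \<partial>lborel)"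
  proof (rule nn_integral_cong)
    fix u :: real
    show "(\<integral>\<^sup>+z. ennreal (k u * (g (z \<bullet> \<nu>) * exp (- (u * (norm z)\<^sup>2)))) \<partial>lborel)
       = (\<integral>\<^sup>+s. ennreal (k u * sqrt (pi / u) ^ (CARD('n) - 1) * (g s * exp (- (u * s\<^sup>2)))) \<partial>lborel)"
    proof (cases "u > 0")
      case True
      then have "(\<integral>\<^sup>+z. ennreal (k u * (g (z \<bullet> \<nu>) * exp (- (u * (norm z)\<^sup>2)))) \<partial>lborel)
        = ennreal (k u) * (ennreal (sqrt (pi / u) ^ (CARD('n) - 1)) * (\<integral>\<^sup>+s. ennreal (g s * exp (- (u * s\<^sup>2))) \<partial>lborel))"
        by (subst nn_integral_ridge_gaussian[OF \<nu> True g g_nonneg, symmetric])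
          (simp add: nn_integral_cmult[symmetric] ennreal_mult g_nonneg k_nonneg)
      also have "\<dots> = (\<integral>\<^sup>+s. ennreal (k u * sqrt (pi / u) ^ (CARD('n) - 1) * (g s * exp (- (u * s\<^sup>2)))) \<partial>lborel)"
        using True by (simp add: nn_integral_cmult[symmetric] ennreal_mult g_nonneg k_nonneg mult.assoc)
      finally show ?thesis .
    qed (simp add: k_def)
  qed
  also have "\<dots> = (\<integral>\<^sup>+s. \<integral>\<^sup>+u. ennreal (k u * sqrt (pi / u) ^ (CARD('n) - 1) * (g s * exp (- (u * s\<^sup>2)))) \<partial>lborel \<partial>lborel)"
    by (rule lborel_pair.Fubini'[symmetric]) measurable
  also have "\<dots> = (\<integral>\<^sup>+s. ennreal (pi powr m * Gamma q) * ennreal (g s * \<bar>s\<bar> powr (- (2 * q))) \<partial>lborel)"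
  proof (rule nn_integral_cong)
    fix s :: real
    show "(\<integral>\<^sup>+u. ennreal (k u * sqrt (pi / u) ^ (CARD('n) - 1) * (g s * exp (- (u * s\<^sup>2)))) \<partial>lborel)
      = ennreal (pi powr m * Gamma q) * ennreal (g s * \<bar>s\<bar> powr (- (2 * q)))"
    proof (cases "s = 0")
      case False
      have "k u * sqrt (pi / u) ^ (CARD('n) - 1) = pi powr m * (indicator {0<..} u * u powr (q - 1))" for u
      proof (cases "u > 0")
        case True
        have "sqrt (pi / u) ^ (CARD('n) - 1) = (pi / u) powr m"
          using True \<open>CARD('n) \<ge> 1\<close>
          by (simp add: powr_half_sqrt[symmetric] powr_realpow[symmetric] powr_powr m_def of_nat_diff)
        also have "\<dots> = pi powr m * u powr - m"
          using True by (simp add: powr_divide powr_minus field_simps)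
        finally show ?thesis
          using True by (simp add: k_def q_def powr_add[symmetric] algebra_simps)
      qed (simp add: k_def)
      then have "(\<integral>\<^sup>+u. ennreal (k u * sqrt (pi / u) ^ (CARD('n) - 1) * (g s * exp (- (u * s\<^sup>2)))) \<partial>lborel)
         = (\<integral>\<^sup>+u. ennreal (pi powr m * g s) * ennreal (indicator {0<..} u * (u powr (q - 1) * exp (- (s\<^sup>2 * u)))) \<partial>lborel)"
        by (intro nn_integral_cong) (simp add: ennreal_mult[symmetric] g_nonneg mult_ac)
      also have "\<dots> = ennreal (pi powr m * g s) * ennreal (Gamma q * (s\<^sup>2) powr - q)"
        using False q_pos by (simp add: nn_integral_cmult nn_integral_powr_exp)
      also have "\<dots> = ennreal (pi powr m * Gamma q) * ennreal (g s * \<bar>s\<bar> powr (- (2 * q)))"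
      proof -
        have "\<bar>s\<bar> powr (- (2 * q)) = (s\<^sup>2) powr - q"
          using False by (subst power2_abs[symmetric]) (simp add: powr_numeral[symmetric] powr_powr del: powr_numeral power2_abs)
        then show ?thesis
          using q_pos by (simp add: ennreal_mult[symmetric] g_nonneg Gamma_real_pos less_imp_le mult_ac)
      qed
      finally show ?thesis .
    qed (simp add: g_0)
  qed
  also have "\<dots> = ennreal (pi powr m * Gamma q) * (\<integral>\<^sup>+s. ennreal (g s * \<bar>s\<bar> powr (- (2 * q))) \<partial>lborel)"
    by (rule nn_integral_cmult) measurable
  finally have eq: "ennreal (Gamma p) * (\<integral>\<^sup>+z. ennreal (g (z \<bullet> \<nu>) * norm z powr (- (2 * p))) \<partial>lborel)
    = ennreal (pi powr m * Gamma q) * (\<integral>\<^sup>+s. ennreal (g s * \<bar>s\<bar> powr (- (2 * q))) \<partial>lborel)" .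
  have "Gamma p > 0" "Gamma q > 0"
    using p_pos q_pos by (simp_all add: Gamma_real_pos)
  then have "(\<integral>\<^sup>+z. ennreal (g (z \<bullet> \<nu>) * norm z powr (- (2 * p))) \<partial>lborel)
    = ennreal (1 / Gamma p) * (ennreal (Gamma p) * (\<integral>\<^sup>+z. ennreal (g (z \<bullet> \<nu>) * norm z powr (- (2 * p))) \<partial>lborel))"
    by (simp add: mult.assoc[symmetric] ennreal_mult[symmetric])
  also have "\<dots> = ennreal (pi powr m * Gamma q / Gamma p) * (\<integral>\<^sup>+s. ennreal (g s * \<bar>s\<bar> powr (- (2 * q))) \<partial>lborel)"
    using \<open>Gamma p > 0\<close> \<open>Gamma q > 0\<close> unfolding eq
    by (simp add: mult.assoc[symmetric] ennreal_mult[symmetric])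
  finally show ?thesis
    by (simp add: q_def m_def algebra_simps diff_divide_distrib)
qed

section \<open>The kernel on a half-space\<close>

text \<open>The antiderivative is \<open>- (s powr - \<alpha> / \<alpha>)\<close>. Both shapes of
  \<open>S\<close> occur: the kernel is integrated over the open half-space if \<open>x\<close> lies
  outside it, and over its closed complement if \<open>x\<close> lies inside.\<close>

lemma nn_integral_powr_tail:
  fixes t \<alpha> :: real
  assumes "t > 0" "\<alpha> > 0" and S: "S = {t<..} \<or> S = {t..}"
  shows "(\<integral>\<^sup>+s. ennreal (indicator S s * s powr (- \<alpha> - 1)) \<partial>lborel) = ennreal (t powr - \<alpha> / \<alpha>)"
proof -
  have "(\<integral>\<^sup>+s. ennreal (indicator S s * s powr (- \<alpha> - 1)) \<partial>lborel)
      = (\<integral>\<^sup>+s. ennreal (s powr (- \<alpha> - 1)) * indicator {t..} s \<partial>lborel)"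
    using S by (intro nn_integral_cong_AE eventually_mono[OF AE_lborel_singleton[of t]])
      (auto simp: indicator_def)
  also have "\<dots> = ennreal (0 - - (t powr - \<alpha> / \<alpha>))"
  proof (rule nn_integral_FTC_atLeast)
    fix s assume "t \<le> s"
    then show "((\<lambda>s. - (s powr - \<alpha> / \<alpha>)) has_real_derivative s powr (- \<alpha> - 1)) (at s)"
      using assms by (auto intro!: derivative_eq_intros simp: powr_diff field_simps)
  next
    have "((\<lambda>s. s powr - \<alpha>) \<longlongrightarrow> 0) at_top"
      using assms by (intro tendsto_neg_powr filterlim_ident) auto
    from tendsto_minus[OF tendsto_divide[OF this tendsto_const[of \<alpha>]]] \<open>\<alpha> > 0\<close>
    show "((\<lambda>s. - (s powr - \<alpha> / \<alpha>)) \<longlongrightarrow> 0) at_top"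
      by simp
  qed auto
  finally show ?thesis
    by simp
qed

text \<open>\<open>nn_integral_ridge_powr\<close> is applied twice: with weight
  \<open>indicator S s\<close> for absolute convergence, and with weight
  \<open>indicator S s * s\<close> for the component along \<open>\<nu>\<close>. Both reduce to the
  same tail integral, finite because \<open>t > 0\<close> and \<open>\<alpha> > 0\<close>.\<close>

lemma has_bochner_integral_halfspace_kernel:
  fixes \<nu> :: "real ^ 'n" and t \<alpha> :: real
  assumes \<nu>: "norm \<nu> = 1" and t: "t > 0" and \<alpha>: "\<alpha> > 0" and S: "S = {t<..} \<or> S = {t..}"
  shows "has_bochner_integral lborel
    (\<lambda>z. (indicator S (z \<bullet> \<nu>) / norm z powr (real CARD('n) + \<alpha> + 1)) *\<^sub>R z)
    ((pi powr ((real CARD('n) - 1) / 2) * Gamma ((\<alpha> + 2) / 2) / Gamma ((real CARD('n) + \<alpha> + 1) / 2)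
      * (t powr - \<alpha> / \<alpha>)) *\<^sub>R \<nu>)"
proof -
  define h where "h z = (indicator S (z \<bullet> \<nu>) / norm z powr (real CARD('n) + \<alpha> + 1)) *\<^sub>R z" for z :: "real ^ 'n"
  define C where "C = pi powr ((real CARD('n) - 1) / 2) * Gamma ((\<alpha> + 2) / 2) / Gamma ((real CARD('n) + \<alpha> + 1) / 2)"
  have S_pos: "s \<in> S \<Longrightarrow> s > 0" for s
    using S t by auto
  have [measurable]: "S \<in> sets borel"
    using S by auto
  have h_meas [measurable]: "h \<in> borel_measurable borel"
    unfolding h_def [abs_def] by measurable
  have "norm (h z) = indicator S (z \<bullet> \<nu>) * norm z powr (- (real CARD('n) + \<alpha>))" for z
    by (cases "z = 0") (auto simp: h_def indicator_def powr_add powr_minus powr_diff divide_simps)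
  \<comment> \<open>The factor \<open>z\<close> lowers the exponent by one, so
    \<open>2 * p = n + \<alpha>\<close> here.\<close>
  then have "(\<integral>\<^sup>+z. ennreal (norm (h z)) \<partial>lborel)
    = (\<integral>\<^sup>+z. ennreal (indicator S (z \<bullet> \<nu>) * norm z powr (- (2 * ((real CARD('n) + \<alpha>) / 2)))) \<partial>lborel)"
    by (intro nn_integral_cong arg_cong[where f = ennreal]) (simp only: mult_2 field_sum_of_halves)
  also have "\<dots> < \<infinity>"
  proof (subst nn_integral_ridge_powr[OF \<nu>])
    have "(\<integral>\<^sup>+s. ennreal (indicator S s * \<bar>s\<bar> powr (real CARD('n) - 1 - 2 * ((real CARD('n) + \<alpha>) / 2))) \<partial>lborel)
      = (\<integral>\<^sup>+s. ennreal (indicator S s * s powr (- \<alpha> - 1)) \<partial>lborel)"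
    proof (intro nn_integral_cong arg_cong[where f = ennreal])
      fix s
      have "real CARD('n) - 1 - 2 * ((real CARD('n) + \<alpha>) / 2) = - \<alpha> - 1"
        by (simp add: field_simps)
      then show "indicator S s * \<bar>s\<bar> powr (real CARD('n) - 1 - 2 * ((real CARD('n) + \<alpha>) / 2))
        = indicator S s * s powr (- \<alpha> - 1)"
        using S_pos[of s] by (simp only:) (auto simp: indicator_def)
    qed
    then show "ennreal (pi powr ((real CARD('n) - 1) / 2)
        * Gamma ((real CARD('n) + \<alpha>) / 2 - (real CARD('n) - 1) / 2) / Gamma ((real CARD('n) + \<alpha>) / 2))
      * (\<integral>\<^sup>+s. ennreal (indicator S s * \<bar>s\<bar> powr (real CARD('n) - 1 - 2 * ((real CARD('n) + \<alpha>) / 2))) \<partial>lborel) < \<infinity>"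
      by (simp add: nn_integral_powr_tail[OF t \<alpha> S] ennreal_mult_less_top)
  qed (use \<alpha> S_pos[of 0] in \<open>auto simp: indicator_def\<close>)
  finally have h_int: "integrable lborel h"
    by (intro integrableI_bounded) auto
  \<comment> \<open>Now \<open>2 * p = n + \<alpha> + 1\<close>: the weight carries the extra factor
    \<open>s\<close>, which restores the tail exponent \<open>- \<alpha> - 1\<close> and makes the
    reduced Gamma argument \<open>(\<alpha> + 2) / 2\<close>.\<close>
  have "2 * ((real CARD('n) + \<alpha> + 1) / 2) = real CARD('n) + \<alpha> + 1"
    by simp
  then have "h z \<bullet> \<nu> = (indicator S (z \<bullet> \<nu>) * (z \<bullet> \<nu>)) * norm z powr (- (2 * ((real CARD('n) + \<alpha> + 1) / 2)))" for z
    by (simp only: h_def inner_scaleR_left powr_minus divide_inverse mult_ac)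
  then have "(\<integral>\<^sup>+z. ennreal (h z \<bullet> \<nu>) \<partial>lborel)
    = (\<integral>\<^sup>+z. ennreal ((indicator S (z \<bullet> \<nu>) * (z \<bullet> \<nu>)) * norm z powr (- (2 * ((real CARD('n) + \<alpha> + 1) / 2)))) \<partial>lborel)"
    by (intro nn_integral_cong arg_cong[where f = ennreal])
  also have "\<dots> = ennreal C * ennreal (t powr - \<alpha> / \<alpha>)"
  proof (subst nn_integral_ridge_powr[OF \<nu>])
    have "(\<integral>\<^sup>+s. ennreal (indicator S s * s * \<bar>s\<bar> powr (real CARD('n) - 1 - 2 * ((real CARD('n) + \<alpha> + 1) / 2))) \<partial>lborel)
      = (\<integral>\<^sup>+s. ennreal (indicator S s * s powr (- \<alpha> - 1)) \<partial>lborel)"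
    proof (intro nn_integral_cong arg_cong[where f = ennreal])
      fix s
      show "indicator S s * s * \<bar>s\<bar> powr (real CARD('n) - 1 - 2 * ((real CARD('n) + \<alpha> + 1) / 2))
        = indicator S s * s powr (- \<alpha> - 1)"
      proof (cases "s \<in> S")
        case True
        have exponent: "real CARD('n) - 1 - 2 * ((real CARD('n) + \<alpha> + 1) / 2) = - \<alpha> - 2"
          by (simp add: field_simps)
        have "s powr (- \<alpha> - 1) = s powr (1 + (- \<alpha> - 2))"
          by (rule arg_cong[where f = "(powr) s"]) simp
        also have "\<dots> = s * s powr (- \<alpha> - 2)"
          using S_pos[OF True] by (simp only: powr_add) simp
        finally show ?thesis
          unfolding exponent using S_pos[OF True] True by simp
      qed simp
    qed
    moreover have "(real CARD('n) + \<alpha> + 1) / 2 - (real CARD('n) - 1) / 2 = (\<alpha> + 2) / 2"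
      by (simp add: field_simps)
    ultimately show "ennreal (pi powr ((real CARD('n) - 1) / 2)
        * Gamma ((real CARD('n) + \<alpha> + 1) / 2 - (real CARD('n) - 1) / 2) / Gamma ((real CARD('n) + \<alpha> + 1) / 2))
      * (\<integral>\<^sup>+s. ennreal (indicator S s * s * \<bar>s\<bar> powr (real CARD('n) - 1 - 2 * ((real CARD('n) + \<alpha> + 1) / 2))) \<partial>lborel)
      = ennreal C * ennreal (t powr - \<alpha> / \<alpha>)"
      by (simp only: nn_integral_powr_tail[OF t \<alpha> S] C_def)
  qed (use \<alpha> S_pos in \<open>auto simp: indicator_def less_imp_le\<close>)
  also have "\<dots> = ennreal (C * (t powr - \<alpha> / \<alpha>))"
    using \<alpha> by (intro ennreal_mult''[symmetric]) simp
  \<comment> \<open>Since \<open>S\<close> contains only positive numbers,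
    \<open>h z \<bullet> \<nu>\<close> is nonnegative, and the value above is its Bochner
    integral.\<close>
  finally have "has_bochner_integral lborel (\<lambda>z. h z \<bullet> \<nu>) (C * (t powr - \<alpha> / \<alpha>))"
    using \<alpha> S_pos by (intro has_bochner_integral_nn_integral)
      (auto simp: C_def h_def indicator_def less_imp_le Gamma_real_pos intro!: mult_nonneg_nonneg divide_nonneg_nonneg)
  then have inner: "integral\<^sup>L lborel h \<bullet> \<nu> = C * (t powr - \<alpha> / \<alpha>)"
    using h_int by (simp add: has_bochner_integral_iff)
  define R where "R z = (2 * (z \<bullet> \<nu>)) *\<^sub>R \<nu> - z" for z :: "real ^ 'n"
  have \<nu>\<nu>: "\<nu> \<bullet> \<nu> = 1"
    using \<nu> by (simp add: norm_eq_1)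
  have R_lin: "linear R"
    by (intro linearI) (simp_all add: R_def inner_add_left algebra_simps)
  have R_inner: "R v \<bullet> R w = v \<bullet> w" for v w
    by (simp add: R_def inner_diff_left inner_diff_right \<nu>\<nu> inner_commute algebra_simps)
  then have R: "orthogonal_transformation R"
    using R_lin by (simp add: orthogonal_transformation_def)
  have R_bl: "bounded_linear R"
    using R_lin by (simp add: linear_conv_bounded_linear)
  then have [measurable]: "R \<in> borel \<rightarrow>\<^sub>M borel"
    by (intro borel_measurable_continuous_onI linear_continuous_on)
  have R_\<nu>: "R z \<bullet> \<nu> = z \<bullet> \<nu>" for z
    by (simp add: R_def inner_diff_left \<nu>\<nu>)
  \<comment> \<open>The scalar factor of \<open>h\<close> depends only on \<open>norm z\<close> and
    \<open>z \<bullet> \<nu>\<close>, both of which \<open>R\<close> preserves. Hence the integral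
    is a fixed point of \<open>R\<close>, that is, a multiple of \<open>\<nu>\<close>.\<close>
  have R_h: "h (R z) = R (h z)" for z
    using R by (simp add: h_def R_\<nu> orthogonal_transformation_norm linear_scale[OF R_lin])
  have "integral\<^sup>L lborel h = (\<integral>z. h (R z) \<partial>lborel)"
    by (subst lborel_distr_orthogonal_transformation[OF R, symmetric]) (simp add: integral_distr)
  also have "\<dots> = R (integral\<^sup>L lborel h)"
    using integral_bounded_linear[OF R_bl h_int] by (simp add: R_h)
  finally have "2 *\<^sub>R integral\<^sup>L lborel h = 2 *\<^sub>R ((integral\<^sup>L lborel h \<bullet> \<nu>) *\<^sub>R \<nu>)"
    by (simp add: R_def scaleR_2 eq_diff_eq)
  then have "integral\<^sup>L lborel h = (integral\<^sup>L lborel h \<bullet> \<nu>) *\<^sub>R \<nu>"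
    by (simp del: scaleR_scaleR)
  then show ?thesis
    using h_int unfolding inner by (simp only: has_bochner_integral_iff h_def [abs_def] C_def)
qed

section \<open>The gradient of the indicator of a half-space\<close>

theorem proposition1p8:
  fixes \<alpha> :: real and \<nu> x0 x :: "real ^ 'n"
  assumes "\<alpha> \<in> {0<..<1}"
    and "\<nu> \<in> sphere 0 1"
    and "x \<in> UNIV - boundary_hyperplane \<nu> x0"
  shows "frac_gradient_exists \<alpha> (indicat_real (open_halfspace \<nu> x0)) x \<and>
    frac_gradient \<alpha> (indicat_real (open_halfspace \<nu> x0)) x =
      (frac_const 1 \<alpha> / \<alpha>) *\<^sub>R ((1 / \<bar>(x - x0) \<bullet> \<nu>\<bar> powr \<alpha>) *\<^sub>R \<nu>)"
proof -
  define d where "d = (x - x0) \<bullet> \<nu>"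
  define c where "c = pi powr ((real CARD('n) - 1) / 2) * Gamma ((\<alpha> + 2) / 2) / Gamma ((real CARD('n) + \<alpha> + 1) / 2)
    * (\<bar>d\<bar> powr - \<alpha> / \<alpha>)"
  define F where "F = frac_integrand \<alpha> (indicat_real (open_halfspace \<nu> x0)) x"
  have \<alpha>: "\<alpha> > 0" and \<nu>: "norm \<nu> = 1" and d: "\<bar>d\<bar> > 0"
    using assms by (auto simp: d_def boundary_hyperplane_def)
  have open_iff: "y \<in> open_halfspace \<nu> x0 \<longleftrightarrow> (y - x) \<bullet> \<nu> > - d" for y
    by (auto simp: open_halfspace_def d_def inner_diff_left)
  have "has_bochner_integral lborel (\<lambda>z. F (x + z)) (c *\<^sub>R \<nu>)"
  \<comment> \<open>If \<open>x\<close> lies in the half-space, the difference of indicators is -1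
    on the complement, which lies in direction \<open>- \<nu>\<close>; the two signs cancel.
    Otherwise the difference is 1 on the half-space itself. Both cases give the coefficient
    \<open>c\<close>.\<close>
  proof (cases "d > 0")
    case True
    have "F (x + z) = - ((indicator {\<bar>d\<bar>..} (z \<bullet> - \<nu>) / norm z powr (real CARD('n) + \<alpha> + 1)) *\<^sub>R z)" for z
      using True by (auto simp: F_def frac_integrand_def indicator_def open_iff)
    then show ?thesis
      using has_bochner_integral_minus[OF has_bochner_integral_halfspace_kernel[of "- \<nu>" "\<bar>d\<bar>" \<alpha> "{\<bar>d\<bar>..}"]] \<nu> d \<alpha>
      by (simp add: c_def)
  next
    case False
    then have "F (x + z) = (indicator {\<bar>d\<bar><..} (z \<bullet> \<nu>) / norm z powr (real CARD('n) + \<alpha> + 1)) *\<^sub>R z" for z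
      using d by (auto simp: F_def frac_integrand_def indicator_def open_iff)
    then show ?thesis
      using has_bochner_integral_halfspace_kernel[of \<nu> "\<bar>d\<bar>" \<alpha> "{\<bar>d\<bar><..}"] \<nu> d \<alpha>
      by (simp add: c_def)
  qed
  moreover have F_meas [measurable]: "F \<in> borel_measurable borel"
    unfolding F_def frac_integrand_def [abs_def] open_halfspace_def by measurable
  ultimately have "has_bochner_integral lborel F (c *\<^sub>R \<nu>)"
    by (subst lborel_distr_plus[symmetric, of x]) (simp add: has_bochner_integral_distr)
  then have "has_bochner_integral lebesgue F (c *\<^sub>R \<nu>)"
    by (simp add: has_bochner_integral_iff integrable_completion integral_completion)
  moreover have "frac_const CARD('n) \<alpha> * c = frac_const 1 \<alpha> / \<alpha> * (1 / \<bar>d\<bar> powr \<alpha>)"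
  proof -
    have "Gamma ((real CARD('n) + \<alpha> + 1) / 2) > 0"
      using \<alpha> by (intro Gamma_real_pos) auto
    \<comment> \<open>The dependence on the dimension disappears: the powers of \<open>pi\<close>
      combine to the one in \<open>frac_const 1 \<alpha>\<close>, the Gamma factors containing
      \<open>CARD('n)\<close> cancel, and \<open>Gamma ((\<alpha> + 2) / 2)\<close> is the numerator
      of \<open>frac_const 1 \<alpha>\<close>.\<close>
    moreover have "pi powr - (real CARD('n) / 2) * pi powr ((real CARD('n) - 1) / 2) = pi powr - (1 / 2)"
      by (simp add: powr_add[symmetric] diff_divide_distrib)
    moreover have "frac_const CARD('n) \<alpha> * c
      = 2 powr \<alpha> * (pi powr - (real CARD('n) / 2) * pi powr ((real CARD('n) - 1) / 2))
        * (Gamma ((real CARD('n) + \<alpha> + 1) / 2) / Gamma ((real CARD('n) + \<alpha> + 1) / 2))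
        * Gamma ((\<alpha> + 2) / 2) / Gamma ((1 - \<alpha>) / 2) * (\<bar>d\<bar> powr - \<alpha> / \<alpha>)"
      by (simp add: frac_const_def c_def mult_ac)
    ultimately show ?thesis
      by (simp add: frac_const_def powr_minus_divide add.commute)
  qed
  ultimately show ?thesis
    by (simp add: frac_gradient_exists_def frac_gradient_def F_def d_def has_bochner_integral_iff)
qed

end
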